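(* Let $q$ be a prime power and let $c\ge1$ be an integer. Let $f$ be a polynomial on $n$ variables over $\mathbb{F}_q$ with at most $n^c$ monomials. Then there exists an affine subspace of $\mathbb{F}_q^n$ of dimension $\Omega\big(n^{1/(4(q-1)c)}\big)$ on which $f$ is constant.
   Context: Polynomials are considered as functions on $\mathbb{F}_q^n$ (one may assume individual degrees at most $q-1$). The constant hidden in $\Omega$ does not depend on $n$. *)

theory Defs
  imports
    "HOL-Analysis.Abstract_Topology_2"
    "HOL-Library.Function_Algebras"
    "HOL-Library.Landau_Symbols"
    "HOL-Library.Poly_Mapping"
begin

(* Vectors over a field 'a are functions nat => 'a; F^n consists of those that vanish from
   index n on, so that the dimension n is an ordinary natural number. *)

definition coord_scale :: "'a::field \<Rightarrow> (nat \<Rightarrow> 'a) \<Rightarrow> nat \<Rightarrow> 'a" where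
  "coord_scale c v = (\<lambda>i. c * v i)"

global_interpretation coord: vector_space "coord_scale :: 'a::field \<Rightarrow> (nat \<Rightarrow> 'a) \<Rightarrow> nat \<Rightarrow> 'a"
  by unfold_locales (auto simp: coord_scale_def fun_eq_iff algebra_simps)

definition coord_space :: "nat \<Rightarrow> (nat \<Rightarrow> 'a::field) set" where
  "coord_space n = {v. \<forall>i\<ge>n. v i = 0}"

definition affine_subspace :: "nat \<Rightarrow> nat \<Rightarrow> (nat \<Rightarrow> 'a::field) set \<Rightarrow> bool" where
  "affine_subspace n d A \<longleftrightarrow>
     (\<exists>a W. a \<in> coord_space n \<and> W \<subseteq> coord_space n \<and> coord.subspace W \<and> coord.dim W = d \<and>
            A = (\<lambda>w. a + w) ` W)"

(* A monomial is its exponent vector, with variables indexed by nat; a polynomial maps finitely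
   many monomials to nonzero coefficients, and keys is the set of these monomials. *)

type_synonym 'a mpoly = "(nat \<Rightarrow>\<^sub>0 nat) \<Rightarrow>\<^sub>0 'a"

definition poly_in_vars :: "nat \<Rightarrow> 'a::zero mpoly \<Rightarrow> bool" where
  "poly_in_vars n f \<longleftrightarrow> (\<forall>m \<in> Poly_Mapping.keys f. Poly_Mapping.keys m \<subseteq> {..<n})"

definition num_monomials :: "'a::zero mpoly \<Rightarrow> nat" where
  "num_monomials f = card (Poly_Mapping.keys f)"

definition poly_eval :: "'a::comm_semiring_1 mpoly \<Rightarrow> (nat \<Rightarrow> 'a) \<Rightarrow> 'a" where
  "poly_eval f x =
     (\<Sum>m \<in> Poly_Mapping.keys f. Poly_Mapping.lookup f m *
        (\<Prod>i \<in> Poly_Mapping.keys m. x i ^ Poly_Mapping.lookup m i))"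

end

theory Submission
  imports
    Defs
    "HOL-Computational_Algebra.Polynomial"
    "HOL-Real_Asymp.Real_Asymp"
begin

text \<open>
  Deleting variables greedily leaves a set \<open>S\<close> of about \<open>\<surd>n\<close> variables such that every monomial with
  more than \<open>2 c\<close> variables vanishes once the variables outside \<open>S\<close> are set to zero. Since
  \<open>x ^ q = x\<close>, what remains is a function of degree at most \<open>d = 2 c (q - 1)\<close>.

  A subspace on which such a function is constant is built one basis vector at a time. Expand the
  function on the span of the first \<open>k\<close> vectors and an unknown vector \<open>x\<close>: the coefficients of the
  \<open>O(k ^ d)\<close> terms that involve \<open>x\<close> are polynomials of degree at most \<open>d\<close> in \<open>x\<close> that vanish at
  \<open>0\<close>. As long as \<open>k ^ d\<close> is small compared to \<open>card S\<close>, Chevalley's theorem yields a common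
  nonzero root.
\<close>

section \<open>Finite fields\<close>

text \<open>Multiplication by \<open>t\<close> permutes the nonzero elements, so their product is
  unchanged when each of them acquires a factor \<open>t\<close>.\<close>

lemma finite_field_power_card_minus_one:
  fixes t :: "'a::{field,finite}"
  assumes "t \<noteq> 0"
  shows "t ^ (card (UNIV :: 'a set) - 1) = 1"
proof -
  have "(\<Prod>y\<in>UNIV - {0}. t * y) = \<Prod>(UNIV - {0 :: 'a})"
    by (rule prod.reindex_bij_witness[of _ "\<lambda>y. y / t" "\<lambda>y. t * y"]) (use assms in auto)
  then have "t ^ card (UNIV - {0 :: 'a}) * \<Prod>(UNIV - {0 :: 'a}) = 1 * \<Prod>(UNIV - {0 :: 'a})"
    by (simp add: prod.distrib)
  then have "t ^ card (UNIV - {0 :: 'a}) = 1"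
    by (subst (asm) mult_cancel_right) auto
  then show ?thesis by simp
qed

lemma card_field_ge_2: "card (UNIV :: 'a::{field,finite} set) \<ge> 2"
  using card_mono[of "UNIV :: 'a set" "{0, 1}"] by simp

text \<open>For \<open>e > 0\<close> some nonzero \<open>g\<close> has
  \<open>g ^ e \<noteq> 1\<close>, because \<open>t ^ e - 1\<close> has too few roots; substituting
  \<open>g * t\<close> for \<open>t\<close> multiplies the sum by \<open>g ^ e\<close> without
  changing it.\<close>

lemma sum_power_finite_field_eq_0:
  assumes e: "e < card (UNIV :: 'a::{field,finite} set) - 1"
  shows "(\<Sum>t\<in>UNIV. t ^ e) = (0 :: 'a)"
proof (cases "e = 0")
  case True
  \<comment> \<open>Translation by 1 permutes the field, so the sum of \<open>card UNIV\<close> ones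
    is zero.\<close>
  have "(\<Sum>t\<in>UNIV. t + 1) = (\<Sum>t\<in>UNIV. t :: 'a)"
    by (rule sum.reindex_bij_witness[of _ "\<lambda>y. y - 1" "\<lambda>y. y + 1"]) auto
  then show ?thesis
    using True by (simp add: sum.distrib)
next
  case False
  define p where "p = (monom 1 e - 1 :: 'a poly)"
  have deg: "degree p \<le> e"
    unfolding p_def by (intro degree_diff_le degree_monom_le) auto
  have "coeff p e = 1"
    using False by (simp add: p_def)
  then have "p \<noteq> 0" by auto
  then have "card {t. poly p t = 0} \<le> e"
    using card_poly_roots_bound deg by (metis order_trans)
  moreover have "card (UNIV - {0 :: 'a}) > e"
    using e by simp
  ultimately have "\<not> UNIV - {0} \<subseteq> {t. poly p t = 0}"
    using card_mono[of "{t. poly p t = 0}" "UNIV - {0}"] by auto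
  then obtain g :: 'a where g: "g \<noteq> 0" "g ^ e \<noteq> 1"
    by (auto simp: p_def poly_monom)
  have "(\<Sum>t\<in>UNIV. (g * t) ^ e) = (\<Sum>t\<in>UNIV. t ^ e)"
    by (rule sum.reindex_bij_witness[of _ "\<lambda>y. y / g" "\<lambda>y. g * y"]) (use g in auto)
  then have "g ^ e * (\<Sum>t\<in>UNIV. t ^ e) = (\<Sum>t\<in>UNIV. t ^ e)"
    by (simp add: power_mult_distrib sum_distrib_left)
  then show ?thesis using g by simp
qed

section \<open>Polynomial functions of bounded degree\<close>

text \<open>A copy of F^S inside the functions on \<open>nat\<close>: restricting to it amounts to
  substituting zero for the variables outside \<open>S\<close>.\<close>

definition supported_on :: "nat set \<Rightarrow> (nat \<Rightarrow> 'a::zero) set" where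
  "supported_on S = {x. \<forall>i. i \<notin> S \<longrightarrow> x i = 0}"

lemma zero_supported_on [simp]: "(\<lambda>_. 0) \<in> supported_on S" "0 \<in> supported_on S"
  by (auto simp: supported_on_def)

lemma supported_on_empty: "supported_on {} = {0}"
  by (auto simp: supported_on_def fun_eq_iff)

lemma bij_betw_supported_on_insert:
  assumes "i \<notin> S"
  shows "bij_betw (\<lambda>(y, t). y(i := t)) (supported_on S \<times> UNIV) (supported_on (insert i S))"
  by (rule bij_betw_byWitness[where f' = "\<lambda>x. (x(i := 0), x i)"])
     (use assms in \<open>auto simp: supported_on_def fun_eq_iff\<close>)

lemma finite_supported_on:
  assumes "finite S"
  shows "finite (supported_on S :: (nat \<Rightarrow> 'a::{zero,finite}) set)"
  using assms
proof induction
  case empty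
  then show ?case by (simp add: supported_on_empty)
next
  case (insert i S)
  then show ?case
    using bij_betw_finite[OF bij_betw_supported_on_insert[of i S, where ?'a = 'a]] by simp
qed

text \<open>A monomial is given by the list of its variables, repeated according to multiplicity.\<close>

inductive polyfun :: "nat set \<Rightarrow> nat \<Rightarrow> ((nat \<Rightarrow> 'a::comm_ring_1) \<Rightarrow> 'a) \<Rightarrow> bool"
  for S d where
  zero: "polyfun S d (\<lambda>_. 0)"
| add_monom: "polyfun S d g \<Longrightarrow> set xs \<subseteq> S \<Longrightarrow> length xs \<le> d \<Longrightarrow>
    polyfun S d (\<lambda>x. g x + c * prod_list (map x xs))"

lemma polyfun_monom:
  assumes "set xs \<subseteq> S" "length xs \<le> d"
  shows "polyfun S d (\<lambda>x. c * prod_list (map x xs))"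
  using polyfun.add_monom[OF polyfun.zero assms, of c] by simp

lemma polyfun_const: "polyfun S d (\<lambda>_. c)"
  using polyfun_monom[of "[]" S d c] by simp

lemma polyfun_coord: "i \<in> S \<Longrightarrow> 1 \<le> d \<Longrightarrow> polyfun S d (\<lambda>x. x i)"
  using polyfun_monom[of "[i]" S d 1] by simp

lemma polyfun_add:
  assumes "polyfun S d g" "polyfun S d h"
  shows "polyfun S d (\<lambda>x. g x + h x)"
  using assms(2)
proof induction
  case zero
  then show ?case using assms(1) by simp
next
  case (add_monom h xs c)
  then show ?case
    using polyfun.add_monom[OF add_monom.IH, of xs c] by (simp add: add.assoc)
qed

lemma polyfun_mono:
  assumes "polyfun S d g" "d \<le> d'"
  shows "polyfun S d' g"
  using assms by induction (auto intro: polyfun.intros)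

lemma polyfun_mult_monom:
  assumes "polyfun S d g" "set xs \<subseteq> S"
  shows "polyfun S (d + length xs) (\<lambda>x. g x * (c * prod_list (map x xs)))"
  using assms(1)
proof induction
  case zero
  then show ?case by (simp add: polyfun.zero)
next
  case (add_monom g ys b)
  have "polyfun S (d + length xs) (\<lambda>x. g x * (c * prod_list (map x xs)) +
      (b * c) * prod_list (map x (ys @ xs)))"
    using add_monom assms by (intro polyfun.add_monom) auto
  then show ?case by (simp add: algebra_simps)
qed

lemma polyfun_mult:
  assumes "polyfun S d g" "polyfun S d' h"
  shows "polyfun S (d + d') (\<lambda>x. g x * h x)"
  using assms(2)
proof induction
  case zero
  then show ?case by (simp add: polyfun.zero)
next
  case (add_monom h xs c)
  have "polyfun S (d + d') (\<lambda>x. g x * (c * prod_list (map x xs)))"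
    using polyfun_mono[OF polyfun_mult_monom[OF assms(1)]] add_monom by auto
  from polyfun_add[OF add_monom.IH this] show ?case
    by (simp add: distrib_left)
qed

lemma polyfun_prod:
  assumes "\<And>i. i \<in> I \<Longrightarrow> polyfun S (d i) (g i)"
  shows "polyfun S (\<Sum>i\<in>I. d i) (\<lambda>x. \<Prod>i\<in>I. g i x)"
  using assms
proof (induction I rule: infinite_finite_induct)
  case (insert i I)
  then show ?case
    using polyfun_mult[of S "d i" "g i" "\<Sum>i\<in>I. d i" "\<lambda>x. \<Prod>i\<in>I. g i x"] by simp
qed (auto intro: polyfun_const)

lemma polyfun_power:
  assumes "polyfun S d g"
  shows "polyfun S (k * d) (\<lambda>x. g x ^ k)"
  using polyfun_prod[of "{..<k}" S "\<lambda>_. d" "\<lambda>_. g"] assms by simp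

lemma polyfun_sum:
  assumes "\<And>i. i \<in> I \<Longrightarrow> polyfun S d (g i)"
  shows "polyfun S d (\<lambda>x. \<Sum>i\<in>I. g i x)"
  using assms
proof (induction I rule: infinite_finite_induct)
  case (insert i I)
  then show ?case
    using polyfun_add[of S d "g i" "\<lambda>x. \<Sum>i\<in>I. g i x"] by simp
qed (auto intro: polyfun_const)

text \<open>On the field, positive exponents that agree modulo \<open>q - 1\<close> give the same
  function, where \<open>q\<close> is the size of the field. Exponent 0 is separate, since
  \<open>t ^ 0\<close> and \<open>t ^ (q - 1)\<close> differ at 0.\<close>

lemma polyfun_coord_power:
  fixes S :: "nat set"
  assumes "i \<in> S"
  shows "polyfun S (card (UNIV :: 'a set) - 1) (\<lambda>x. x i ^ e :: 'a::{field,finite})"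
proof -
  define q1 where "q1 = card (UNIV :: 'a set) - 1"
  have q1: "q1 \<ge> 1"
    using card_field_ge_2[where ?'a = 'a] by (simp add: q1_def)
  have red: "t ^ (e + q1 * k) = t ^ e" if "e > 0" for e k and t :: 'a
    using that finite_field_power_card_minus_one[of t]
    by (cases "t = 0") (auto simp: power_add power_mult q1_def)
  show ?thesis
  proof (cases "e = 0")
    case True
    then show ?thesis by (simp add: polyfun_const)
  next
    case False
    \<comment> \<open>The representative of \<open>e\<close> is taken in 1, ..., \<open>q1\<close>
      instead of 0, ..., \<open>q1 - 1\<close>, so that the reduced power still vanishes at
      0.\<close>
    define r where "r = Suc ((e - 1) mod q1)"
    have "e = r + q1 * ((e - 1) div q1)"
      using False by (simp add: r_def)
    then have "x i ^ e = x i ^ r" for x :: "nat \<Rightarrow> 'a"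
      using red[of r "x i"] by (metis r_def zero_less_Suc)
    moreover have "polyfun S (r * 1) (\<lambda>x. x i ^ r :: 'a)"
      using assms by (intro polyfun_power polyfun_coord) auto
    moreover have "r \<le> q1"
      using q1 by (simp add: r_def Suc_le_eq)
    ultimately show ?thesis
      unfolding q1_def[symmetric] by (auto intro: polyfun_mono)
  qed
qed

section \<open>Chevalley's theorem\<close>

text \<open>Isolates the variable \<open>i\<close>: giving it the value 1 removes its factors from
  the rest of the monomial.\<close>

lemma prod_list_fun_upd:
  "prod_list (map (y(i := t)) xs) = t ^ count_list xs i * prod_list (map (y(i := 1)) xs)"
  for t :: "'a::comm_monoid_mult"
  by (induction xs) (auto simp: algebra_simps)

text \<open>By pigeonhole some variable in \<open>S\<close> has exponent below \<open>q - 1\<close>,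
  where \<open>q\<close> is the size of the field. Summing over that variable first already gives
  zero.\<close>

lemma sum_monom_supported_on_eq_0:
  assumes S: "finite S" "set xs \<subseteq> S"
    and len: "length xs < card S * (card (UNIV :: 'a::{field,finite} set) - 1)"
  shows "(\<Sum>x\<in>supported_on S. prod_list (map x xs)) = (0 :: 'a)"
proof -
  define q1 where "q1 = card (UNIV :: 'a set) - 1"
  have "\<exists>i\<in>S. count_list xs i < q1"
  proof (rule ccontr)
    assume "\<not> ?thesis"
    then have "card S * q1 \<le> (\<Sum>i\<in>S. count_list xs i)"
      using sum_mono[of S "\<lambda>_. q1" "count_list xs"] by (simp add: not_less)
    then show False
      using len S by (simp add: sum_count_set q1_def)
  qed
  then obtain i where i: "i \<in> S" "count_list xs i < q1" by blast
  define R where "R = S - {i}"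
  have R: "S = insert i R" "i \<notin> R"
    using i by (auto simp: R_def)
  have "(\<Sum>x\<in>supported_on S. prod_list (map x xs)) =
      (\<Sum>(y, t)\<in>supported_on R \<times> UNIV. prod_list (map (y(i := t)) xs :: 'a list))"
    unfolding R(1)
    by (subst sum.reindex_bij_betw[OF bij_betw_supported_on_insert[OF R(2)], symmetric])
       (simp add: case_prod_unfold)
  also have "\<dots> = (\<Sum>y\<in>supported_on R. \<Sum>t\<in>UNIV. prod_list (map (y(i := t)) xs))"
    by (simp add: sum.cartesian_product)
  also have "\<dots> = (\<Sum>y\<in>supported_on R.
      (\<Sum>t\<in>UNIV. t ^ count_list xs i) * prod_list (map (y(i := 1)) xs))"
    by (subst prod_list_fun_upd) (simp add: sum_distrib_right)
  also have "\<dots> = 0"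
    using i(2) by (subst sum_power_finite_field_eq_0) (auto simp: q1_def)
  finally show ?thesis .
qed

lemma sum_polyfun_supported_on_eq_0:
  assumes "polyfun S d g" "finite S"
    and "d < card S * (card (UNIV :: 'a::{field,finite} set) - 1)"
  shows "(\<Sum>x\<in>supported_on S. g x) = (0 :: 'a)"
  using assms(1)
proof induction
  case (add_monom g xs c)
  have "(\<Sum>x\<in>supported_on S. prod_list (map x xs)) = (0 :: 'a)"
    using add_monom assms by (intro sum_monom_supported_on_eq_0) auto
  then show ?case
    using add_monom.IH by (simp add: sum.distrib flip: sum_distrib_left)
qed simp

text \<open>The product \<open>P\<close> of the factors \<open>1 - g ^ (q - 1)\<close> is the
  indicator of the common roots, where \<open>q\<close> is the size of the field. If 0 were the only
  root in F^S, the values of \<open>P\<close> would sum to 1, but the degree of \<open>P\<close> is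
  small enough to make this sum vanish.\<close>

theorem chevalley:
  fixes G :: "((nat \<Rightarrow> 'a::{field,finite}) \<Rightarrow> 'a) set"
  assumes "finite S" "finite G"
    and G: "\<And>g. g \<in> G \<Longrightarrow> polyfun S d g" "\<And>g. g \<in> G \<Longrightarrow> g 0 = 0"
    and less: "card G * d < card S"
  shows "\<exists>x\<in>supported_on S. x \<noteq> 0 \<and> (\<forall>g\<in>G. g x = 0)"
proof (rule ccontr)
  assume "\<not> ?thesis"
  \<comment> \<open>Each nonzero point is therefore killed by one factor of the product
    \<open>P\<close> below.\<close>
  then have ex: "\<exists>g\<in>G. g x \<noteq> 0" if "x \<in> supported_on S" "x \<noteq> 0" for x
    using that by blast
  define q1 where "q1 = card (UNIV :: 'a set) - 1"
  have q1: "q1 \<ge> 1"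
    using card_field_ge_2[where ?'a = 'a] by (simp add: q1_def)
  define P where "P x = (\<Prod>g\<in>G. 1 + (-1) * g x ^ q1)" for x
  have "polyfun S (\<Sum>g\<in>G. 0 + q1 * d) P"
    unfolding P_def
    by (intro polyfun_prod polyfun_add polyfun_mult polyfun_const polyfun_power)
       (auto intro: G polyfun_mono polyfun_const polyfun_mult polyfun_power)
  moreover have "(\<Sum>g\<in>G. 0 + q1 * d) < card S * q1"
    using less q1 by (simp add: mult.commute mult.left_commute)
  ultimately have "(\<Sum>x\<in>supported_on S. P x) = 0"
    using assms(1) by (intro sum_polyfun_supported_on_eq_0) (auto simp: q1_def)
  moreover have "P x = 0" if x: "x \<in> supported_on S" "x \<noteq> 0" for x
  proof -
    obtain g where "g \<in> G" "g x \<noteq> 0" using ex x by blast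
    then have "1 + (-1) * g x ^ q1 = 0"
      using finite_field_power_card_minus_one[of "g x"] by (simp add: q1_def)
    then show ?thesis
      unfolding P_def using \<open>g \<in> G\<close> \<open>finite G\<close> by (intro prod_zero) auto
  qed
  then have "(\<Sum>x\<in>supported_on S. P x) = (\<Sum>x\<in>{0}. P x)"
    using finite_supported_on[OF assms(1)] by (intro sum.mono_neutral_right) auto
  moreover have "P 0 = 1"
    unfolding P_def using G(2) q1 by (intro prod.neutral) (auto simp: power_0_left)
  ultimately show False by simp
qed

section \<open>Subspaces on which a polynomial of bounded degree is constant\<close>

text \<open>Multiplying out means choosing one summand from each factor; the word \<open>os\<close>
  records the choices.\<close>

lemma prod_list_sum_expand:
  fixes a :: "'b \<Rightarrow> 'a::comm_semiring_1"
  assumes "finite U"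
  shows "prod_list (map (\<lambda>i. \<Sum>o'\<in>U. a o' * w o' i) xs) =
    (\<Sum>os | set os \<subseteq> U \<and> length os = length xs.
       prod_list (map a os) * prod_list (map2 w os xs))"
proof (induction xs)
  case Nil
  have "{os. set os \<subseteq> U \<and> os = []} = {[]}" by auto
  then show ?case by simp
next
  case (Cons i xs)
  let ?L = "{os. set os \<subseteq> U \<and> length os = length xs}"
  have "(\<Sum>os | set os \<subseteq> U \<and> length os = length (i # xs).
       prod_list (map a os) * prod_list (map2 w os (i # xs))) =
     (\<Sum>os\<in>(\<lambda>(os, o'). o' # os) ` (?L \<times> U).
       prod_list (map a os) * prod_list (map2 w os (i # xs)))"
    by (simp add: lists_length_Suc_eq)
  also have "\<dots> = (\<Sum>(os, o')\<in>?L \<times> U.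
       (a o' * w o' i) * (prod_list (map a os) * prod_list (map2 w os xs)))"
    by (subst sum.reindex) (auto simp: inj_on_def case_prod_unfold algebra_simps intro!: sum.cong)
  also have "\<dots> = (\<Sum>o'\<in>U. a o' * w o' i) *
      (\<Sum>os\<in>?L. prod_list (map a os) * prod_list (map2 w os xs))"
    by (subst sum.cartesian_product[symmetric], subst sum.swap)
       (simp add: sum_product)
  finally show ?case using Cons by simp
qed

text \<open>\<open>None\<close> stands for the unknown vector \<open>x\<close> and
  \<open>Some b\<close> for a known vector \<open>b\<close>. The coefficients \<open>C os\<close>
  depend on neither \<open>U\<close> nor \<open>a\<close>. Each \<open>None\<close> in a word
  contributes a coordinate of \<open>x\<close> as a factor, whence the degree bound and the
  vanishing at 0.\<close>

lemma polyfun_expand: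
  fixes g :: "(nat \<Rightarrow> 'a::comm_ring_1) \<Rightarrow> 'a"
  assumes "polyfun S d g"
  shows "\<exists>C. (\<forall>U a x. finite U \<longrightarrow>
        g (\<lambda>i. \<Sum>o'\<in>U. a o' * case_option x id o' i) =
        (\<Sum>os | set os \<subseteq> U \<and> length os \<le> d. prod_list (map a os) * C os x)) \<and>
      (\<forall>os. polyfun S d (C os)) \<and>
      (\<forall>os. None \<in> set os \<longrightarrow> C os 0 = 0)"
  using assms
proof induction
  case zero
  show ?case
    by (rule exI[of _ "\<lambda>_ _. 0"]) (auto simp: polyfun_const)
next
  case (add_monom g xs c)
  then obtain C where
    C: "\<And>U a x. finite U \<Longrightarrow> g (\<lambda>i. \<Sum>o'\<in>U. a o' * case_option x id o' i) =
          (\<Sum>os | set os \<subseteq> U \<and> length os \<le> d. prod_list (map a os) * C os x)"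
      "\<And>os. polyfun S d (C os)" "\<And>os. None \<in> set os \<Longrightarrow> C os 0 = 0"
    by blast
  define M :: "(nat \<Rightarrow> 'a) option list \<Rightarrow> (nat \<Rightarrow> 'a) \<Rightarrow> 'a"
    where "M os x = prod_list (map2 (case_option x id) os xs)" for os x
  \<comment> \<open>A monomial \<open>xs\<close> only meets words of its own length, one vector for
    each of its factors.\<close>
  define C' where "C' os x = C os x + (if length os = length xs then c * M os x else 0)" for os x
  have M: "polyfun S (length os) (M os)" if "length os = length xs" for os
    using that \<open>set xs \<subseteq> S\<close> unfolding M_def
  proof (induction os xs rule: list_induct2)
    case Nil
    then show ?case by (simp add: polyfun_const)
  next
    case (Cons o' os i xs)
    have "polyfun S 1 (\<lambda>x. case_option x id o' i)"
      using Cons by (cases o') (auto intro: polyfun_const polyfun_coord)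
    from polyfun_mult[OF this Cons.IH] Cons.prems show ?case by simp
  qed
  have M0: "M os 0 = 0" if "length os = length xs" "None \<in> set os" for os
    using that unfolding M_def by (induction os xs rule: list_induct2) auto
  show ?case
  proof (intro exI[of _ C'] conjI allI impI)
    fix os
    have "polyfun S d (\<lambda>x. c * M os x)" if "length os = length xs"
      using polyfun_mono[OF polyfun_mult[OF polyfun_const[of S 0 c] M[OF that]]] add_monom that
      by simp
    then show "polyfun S d (C' os)"
      unfolding C'_def using C(2)[of os]
      by (cases "length os = length xs") (auto intro: polyfun_add)
  next
    fix os :: "(nat \<Rightarrow> 'a) option list"
    assume "None \<in> set os"
    then show "C' os 0 = 0"
      using C(3) M0 by (simp add: C'_def)
  next
    fix U :: "(nat \<Rightarrow> 'a) option set" and a x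
    assume U: "finite U"
    let ?L = "{os. set os \<subseteq> U \<and> length os \<le> d}"
    have "(\<Sum>os | set os \<subseteq> U \<and> length os = length xs. prod_list (map a os) * M os x) =
      (\<Sum>os\<in>?L. prod_list (map a os) * (if length os = length xs then M os x else 0))"
      using add_monom finite_lists_length_le[OF U]
      by (intro sum.mono_neutral_cong_left) auto
    then have "c * prod_list (map (\<lambda>i. \<Sum>o'\<in>U. a o' * case_option x id o' i) xs) =
      c * (\<Sum>os\<in>?L. prod_list (map a os) * (if length os = length xs then M os x else 0))"
      by (subst prod_list_sum_expand[OF U]) (simp add: M_def)
    also have "\<dots> = (\<Sum>os\<in>?L. prod_list (map a os) * (if length os = length xs then c * M os x else 0))"
      by (subst sum_distrib_left) (auto intro!: sum.cong)
    finally show "g (\<lambda>i. \<Sum>o'\<in>U. a o' * case_option x id o' i) +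
        c * prod_list (map (\<lambda>i. \<Sum>o'\<in>U. a o' * case_option x id o' i) xs) =
      (\<Sum>os\<in>?L. prod_list (map a os) * C' os x)"
      by (simp add: C(1)[OF U] C'_def distrib_left sum.distrib)
  qed
qed

lemma sum_fun_apply: "(\<Sum>i\<in>I. f i) x = (\<Sum>i\<in>I. f i x)"
  for f :: "'i \<Rightarrow> 'b \<Rightarrow> 'c::comm_monoid_add"
  by (induction I rule: infinite_finite_induct) auto

text \<open>Chevalley's theorem is applied to the coefficients of all words that involve
  \<open>x\<close>, together with the coordinates in \<open>P\<close>. Once these vanish,
  \<open>g\<close> no longer sees the component along \<open>x\<close>, so its values on the larger
  span are those on \<open>coord.span B\<close>.\<close>

lemma polyfun_const_subspace_step:
  fixes g :: "(nat \<Rightarrow> 'a::{field,finite}) \<Rightarrow> 'a"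
  assumes g: "polyfun S d g" and d: "d \<ge> 1" and S: "finite S"
    and B: "finite B" "card B = k" "\<And>v. v \<in> coord.span B \<Longrightarrow> g v = g 0"
    and P: "finite P" "card P = k"
    and less: "d * (d + 2) * Suc k ^ d < card S"
  shows "\<exists>x\<in>supported_on S. x \<noteq> 0 \<and> (\<forall>p\<in>P \<inter> S. x p = 0) \<and>
    (\<forall>v\<in>coord.span (insert x B). g v = g 0)"
proof -
  define U where "U = insert None (Some ` B)"
  have U: "finite U" "card U = Suc k"
    using B by (auto simp: U_def card_insert_if card_image)
  obtain C where
    C: "\<And>U a x. finite U \<Longrightarrow> g (\<lambda>i. \<Sum>o'\<in>U. a o' * case_option x id o' i) =
          (\<Sum>os | set os \<subseteq> U \<and> length os \<le> d. prod_list (map a os) * C os x)"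
      "\<And>os. polyfun S d (C os)" "\<And>os. None \<in> set os \<Longrightarrow> C os 0 = 0"
    using polyfun_expand[OF g] by blast
  define L where "L = {os. set os \<subseteq> U \<and> length os \<le> d}"
  define G where "G = C ` {os \<in> L. None \<in> set os} \<union> (\<lambda>p x. x p) ` (P \<inter> S)"
  have finL: "finite L"
    unfolding L_def using U by (intro finite_lists_length_le) auto
  \<comment> \<open>There are at most \<open>(d + 1) * Suc k ^ d\<close> words, and the
    \<open>k\<close> coordinate functions fit into one further \<open>Suc k ^ d\<close>; this
    explains the factor \<open>d + 2\<close>.\<close>
  have "card L = (\<Sum>m\<le>d. Suc k ^ m)"
    unfolding L_def using U by (simp add: card_lists_length_le)
  also have "\<dots> \<le> (\<Sum>m\<le>d. Suc k ^ d)"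
    by (intro sum_mono power_increasing) auto
  finally have cardL: "card L \<le> (d + 1) * Suc k ^ d" by simp
  have "card G \<le> card (C ` {os \<in> L. None \<in> set os}) + card ((\<lambda>p x. x p :: 'a) ` (P \<inter> S))"
    unfolding G_def by (rule card_Un_le)
  also have "card (C ` {os \<in> L. None \<in> set os}) \<le> card L"
    using finL by (intro order_trans[OF card_image_le] card_mono) auto
  also have "card ((\<lambda>p x. x p :: 'a) ` (P \<inter> S)) \<le> card P"
    using P by (intro order_trans[OF card_image_le] card_mono) auto
  also have "card P \<le> Suc k ^ d"
    using P d power_increasing[of 1 d "Suc k"] by simp
  finally have "card G \<le> (d + 2) * Suc k ^ d"
    using cardL by simp
  then have "d * card G \<le> d * ((d + 2) * Suc k ^ d)"
    by (rule mult_le_mono2)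
  then have "card G * d \<le> d * (d + 2) * Suc k ^ d"
    by (simp only: mult_ac)
  with less have cG: "card G * d < card S" by simp
  have "\<exists>x\<in>supported_on S. x \<noteq> 0 \<and> (\<forall>h\<in>G. h x = 0)"
  proof (rule chevalley[OF S _ _ _ cG])
    show "finite G"
      using finL P by (auto simp: G_def)
  next
    fix h assume "h \<in> G"
    then show "polyfun S d h" "h 0 = 0"
      using C(2,3) d by (auto simp: G_def intro: polyfun_coord)
  qed
  then obtain x where x: "x \<in> supported_on S" "x \<noteq> 0" "\<And>h. h \<in> G \<Longrightarrow> h x = 0"
    by blast
  have eval: "g (\<lambda>i. \<Sum>o'\<in>U. a o' * case_option x id o' i) =
      (\<Sum>os\<in>{os\<in>L. None \<notin> set os}. prod_list (map a os) * C os x)" for a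
    unfolding C(1)[OF U(1)] L_def[symmetric]
    using finL x(3) by (intro sum.mono_neutral_right) (auto simp: G_def)
  \<comment> \<open>\<open>case_option t u\<close> assigns the coefficient \<open>t\<close> to
    \<open>x\<close> and \<open>u b\<close> to \<open>b\<close>.\<close>
  have span: "v + coord_scale t x = (\<lambda>i. \<Sum>o'\<in>U. case_option t u o' * case_option x id o' i)"
    if "v = (\<Sum>b\<in>B. coord_scale (u b) b)" for v t u
    using that B(1)
    by (simp add: U_def fun_eq_iff coord_scale_def sum_fun_apply sum.reindex add.commute)
  have "g v = g 0" if v: "v \<in> coord.span (insert x B)" for v
  proof -
    obtain t where t: "v - coord_scale t x \<in> coord.span B"
      using v unfolding coord.span_insert by blast
    then obtain u where u: "v - coord_scale t x = (\<Sum>b\<in>B. coord_scale (u b) b)"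
      using B(1) by (auto simp: coord.span_finite)
    have "g v = g ((v - coord_scale t x) + coord_scale t x)" by simp
    also have "\<dots> = (\<Sum>os\<in>{os\<in>L. None \<notin> set os}. prod_list (map (case_option t u) os) * C os x)"
      unfolding span[OF u] eval ..
    \<comment> \<open>The remaining words avoid \<open>None\<close>, so the coefficient
      \<open>t\<close> of \<open>x\<close> may be replaced by 0.\<close>
    also have "\<dots> = (\<Sum>os\<in>{os\<in>L. None \<notin> set os}. prod_list (map (case_option 0 u) os) * C os x)"
    proof (rule sum.cong[OF refl])
      fix os assume "os \<in> {os\<in>L. None \<notin> set os}"
      then have "map (case_option t u) os = map (case_option 0 u) os"
        by (auto split: option.split)
      then show "prod_list (map (case_option t u) os) * C os x =
        prod_list (map (case_option 0 u) os) * C os x" by (simp only:)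
    qed
    also have "\<dots> = g ((v - coord_scale t x) + coord_scale 0 x)"
      unfolding span[OF u] eval ..
    also have "coord_scale 0 x = 0"
      by (auto simp: coord_scale_def)
    finally show ?thesis
      using B(3)[OF t] by (simp only: add_0_right)
  qed
  then show ?thesis
    using x by (intro bexI[of _ x]) (auto simp: G_def)
qed

lemma subspace_supported_on: "coord.subspace (supported_on S)"
  by (auto simp: coord.subspace_def supported_on_def coord_scale_def)

text \<open>The pivot set \<open>P\<close> is only needed to keep the vector found by Chevalley's theorem
  outside the span of the previous ones.\<close>

lemma polyfun_const_basis:
  fixes g :: "(nat \<Rightarrow> 'a::{field,finite}) \<Rightarrow> 'a"
  assumes g: "polyfun S d g" and d: "d \<ge> 1" and S: "finite S"
    and less: "d * (d + 2) * k ^ d < card S"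
  shows "\<exists>B P. finite B \<and> card B = k \<and> coord.independent B \<and> B \<subseteq> supported_on S \<and>
    (\<forall>v\<in>coord.span B. g v = g 0) \<and>
    P \<subseteq> S \<and> card P = k \<and> (\<forall>v\<in>coord.span B. (\<forall>p\<in>P. v p = 0) \<longrightarrow> v = 0)"
  using less
proof (induction k)
  case 0
  show ?case
    by (rule exI[of _ "{}"], rule exI[of _ "{}"]) (auto simp: coord.dependent_def)
next
  case (Suc k)
  have "d * (d + 2) * k ^ d \<le> d * (d + 2) * Suc k ^ d"
    by (intro mult_left_mono power_mono) auto
  with Suc obtain B P where
    B: "finite B" "card B = k" "coord.independent B" "B \<subseteq> supported_on S"
      "\<And>v. v \<in> coord.span B \<Longrightarrow> g v = g 0" and
    P: "P \<subseteq> S" "card P = k" and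
    BP: "\<And>v. v \<in> coord.span B \<Longrightarrow> (\<forall>p\<in>P. v p = 0) \<Longrightarrow> v = 0"
    by (metis (no_types, lifting) le_less_trans)
  have finP: "finite P" using P S finite_subset by blast
  obtain x where x: "x \<in> supported_on S" "x \<noteq> 0" "\<forall>p\<in>P \<inter> S. x p = 0"
    "\<forall>v\<in>coord.span (insert x B). g v = g 0"
    using polyfun_const_subspace_step[OF g d S B(1,2,5) finP P(2) Suc.prems] by blast
  have xP: "x p = 0" if "p \<in> P" for p using x(3) P that by blast
  \<comment> \<open>The vector \<open>x\<close> is nonzero and vanishes on \<open>P\<close>, which
    no nonzero vector of \<open>coord.span B\<close> does.\<close>
  have x_span: "x \<notin> coord.span B"
    using BP x xP by blast
  then have xB: "x \<notin> B"
    using coord.span_base by blast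
  \<comment> \<open>Any coordinate where \<open>x\<close> is nonzero serves as the new pivot; it is
    outside \<open>P\<close> because \<open>x\<close> vanishes there.\<close>
  obtain p where p: "x p \<noteq> 0" using x(2) by (auto simp: fun_eq_iff)
  then have pS: "p \<in> S" "p \<notin> P" using x(1) xP by (auto simp: supported_on_def)
  show ?case
  proof (intro exI conjI)
    show "finite (insert x B)" "card (insert x B) = Suc k" using B xB by auto
    show "coord.independent (insert x B)"
      using coord.independent_insertI x_span B by blast
    show "insert x B \<subseteq> supported_on S" using x B by blast
    show "\<forall>v\<in>coord.span (insert x B). g v = g 0" by fact
    show "insert p P \<subseteq> S" "card (insert p P) = Suc k" using pS P finP by auto
    show "\<forall>v\<in>coord.span (insert x B). (\<forall>p\<in>insert p P. v p = 0) \<longrightarrow> v = 0"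
    proof (intro ballI impI)
      fix v assume v: "v \<in> coord.span (insert x B)" "\<forall>p\<in>insert p P. v p = 0"
      obtain t where t: "v - coord_scale t x \<in> coord.span B"
        using v(1) unfolding coord.span_insert by blast
      \<comment> \<open>Both \<open>v\<close> and \<open>x\<close> vanish on \<open>P\<close>, so
        the old pivots force \<open>v\<close> to be a multiple of \<open>x\<close>; the new pivot
        then forces the multiple to be zero.\<close>
      have "v - coord_scale t x = 0"
        using BP[OF t] v xP by (auto simp: coord_scale_def)
      then have "v p = t * x p" "v = coord_scale t x"
        by (auto simp: coord_scale_def fun_eq_iff)
      then show "v = 0"
        using v p by (auto simp: coord_scale_def fun_eq_iff)
    qed
  qed
qed

section \<open>Sparse polynomials\<close>

text \<open>Double counting: there are at least \<open>r * card T\<close> incidences between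
  \<open>U\<close> and the sets \<open>K t\<close>, and some element attains at least the
  average.\<close>

lemma exists_element_in_many:
  assumes "finite U" "finite T" "\<And>t. t \<in> T \<Longrightarrow> K t \<subseteq> U \<and> r \<le> card (K t)" "U \<noteq> {}"
  shows "\<exists>i\<in>U. r * card T \<le> card U * card {t\<in>T. i \<in> K t}"
proof (rule ccontr)
  assume "\<not> ?thesis"
  then have *: "card U * card {t\<in>T. i \<in> K t} < r * card T" if "i \<in> U" for i
    using that by (auto simp: not_le)
  have "(\<Sum>i\<in>U. card {t\<in>T. i \<in> K t}) = (\<Sum>i\<in>U. \<Sum>t\<in>T. if i \<in> K t then 1 else 0)"
    using assms by (simp add: card_eq_sum sum.inter_filter del: sum_constant One_nat_def)
  also have "\<dots> = (\<Sum>t\<in>T. \<Sum>i\<in>U. if i \<in> K t then 1 else 0)"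
    by (rule sum.swap)
  also have "\<dots> = (\<Sum>t\<in>T. card {i\<in>U. i \<in> K t})"
    using assms by (simp add: card_eq_sum sum.inter_filter del: sum_constant One_nat_def)
  also have "\<dots> = (\<Sum>t\<in>T. card (K t))"
    using assms(3) by (intro sum.cong refl arg_cong[of _ _ card]) auto
  also have "\<dots> \<ge> (\<Sum>t\<in>T. r)"
    using assms by (intro sum_mono) auto
  finally have "card U * (r * card T) \<le> (\<Sum>i\<in>U. card U * card {t\<in>T. i \<in> K t})"
    by (simp add: mult_ac flip: sum_distrib_left)
  also have "\<dots> < (\<Sum>i\<in>U. r * card T)"
    using assms * by (intro sum_strict_mono) auto
  finally show False by simp
qed

text \<open>Deleting a most popular element of \<open>U\<close> multiplies the number of surviving sets by at most
  \<open>1 - r / m \<le> ((m - 1) / m) ^ r\<close>, where \<open>m = card U\<close>, and these factors telescope.\<close>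

lemma exists_subset_containing_few:
  fixes K :: "'b \<Rightarrow> 'a set"
  assumes "finite U" "finite T" "1 \<le> N" "N \<le> card U"
    and "\<And>t. t \<in> T \<Longrightarrow> K t \<subseteq> U \<and> r \<le> card (K t)"
  shows "\<exists>S\<subseteq>U. card S = N \<and> card {t\<in>T. K t \<subseteq> S} * card U ^ r \<le> card T * N ^ r"
  using assms
proof (induction "card U" arbitrary: U T)
  case (Suc m)
  show ?case
  proof (cases "N = Suc m")
    case True
    have "card {t\<in>T. K t \<subseteq> U} \<le> card T"
      using Suc.prems by (intro card_mono) auto
    then show ?thesis
      using True Suc.hyps by (intro exI[of _ U]) auto
  next
    case False
    then have m: "N \<le> m" "m \<ge> 1" using Suc by auto
    obtain i where i: "i \<in> U" "r * card T \<le> card U * card {t\<in>T. i \<in> K t}"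
      using exists_element_in_many[of U T K r] Suc.prems Suc.hyps by fastforce
    \<comment> \<open>The sets that survive the deletion of \<open>i\<close>; they lie in
      \<open>U - {i}\<close>, so the induction hypothesis applies to them.\<close>
    define T' where "T' = {t\<in>T. i \<notin> K t}"
    have cU: "card (U - {i}) = m" using i Suc by simp
    have "\<exists>S\<subseteq>U - {i}. card S = N \<and> card {t\<in>T'. K t \<subseteq> S} * card (U - {i}) ^ r \<le> card T' * N ^ r"
      using Suc.prems m cU by (intro Suc.hyps(1)) (auto simp: T'_def)
    then obtain S where S: "S \<subseteq> U - {i}" "card S = N"
      "card {t\<in>T'. K t \<subseteq> S} * m ^ r \<le> card T' * N ^ r"
      unfolding cU by blast
    have eq: "{t\<in>T'. K t \<subseteq> S} = {t\<in>T. K t \<subseteq> S}"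
      using S(1) by (auto simp: T'_def)
    have "T = T' \<union> {t\<in>T. i \<in> K t}" by (auto simp: T'_def)
    then have "card T = card T' + card {t\<in>T. i \<in> K t}"
      using Suc.prems card_Un_disjoint[of T' "{t\<in>T. i \<in> K t}"] by (auto simp: T'_def)
    then have "r * card T + Suc m * card T' \<le> Suc m * card T"
      using i(2) Suc.hyps(2) by (simp add: algebra_simps)
    then have "real (r * card T + Suc m * card T') \<le> real (Suc m * card T)"
      by (rule of_nat_mono)
    then have "real (card T') \<le> real (card T) * (1 + real r * (- 1 / Suc m))"
      by (simp add: field_simps)
    also have "\<dots> \<le> real (card T) * (1 + (- 1 / Suc m)) ^ r"
      by (intro mult_left_mono Bernoulli_inequality) auto
    also have "1 + (- 1 / real (Suc m)) = real m / real (Suc m)"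
      by (simp add: field_simps)
    finally have "real (card T') * Suc m ^ r \<le> real (card T) * m ^ r"
      by (simp add: power_divide field_simps)
    then have "real (card T' * Suc m ^ r) \<le> real (card T * m ^ r)" by simp
    then have T': "card T' * Suc m ^ r \<le> card T * m ^ r"
      by (simp only: of_nat_le_iff)
    have "card {t\<in>T. K t \<subseteq> S} * Suc m ^ r * m ^ r \<le> (card T' * N ^ r) * Suc m ^ r"
      using mult_le_mono1[OF S(3), of "Suc m ^ r"] unfolding eq by (simp only: mult_ac)
    also have "\<dots> \<le> card T * N ^ r * m ^ r"
      using mult_le_mono1[OF T', of "N ^ r"] by (simp only: mult_ac)
    finally have "card {t\<in>T. K t \<subseteq> S} * Suc m ^ r \<le> card T * N ^ r"
      using m by (subst (asm) mult_le_cancel2) auto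
    then show ?thesis
      using S Suc.hyps(2) by (intro exI[of _ S]) auto
  qed
qed simp

text \<open>Fewer than \<open>n ^ c * (N / n) ^ (2 * c + 1) \<le> N / n < 1\<close> wide monomials
  would be expected inside a suitable \<open>S\<close>, up to equality in the first bound, so none
  is left. Every monomial inside \<open>S\<close> has at most \<open>2 * c\<close> variables, each
  of degree at most \<open>q - 1\<close> after reduction, where \<open>q\<close> is the size of the
  field.\<close>

lemma sparse_restriction_polyfun:
  fixes f :: "'a::{field,finite} mpoly"
  assumes f: "poly_in_vars n f" "num_monomials f \<le> n ^ c"
    and N: "1 \<le> N" "N\<^sup>2 \<le> n" "N < n"
  shows "\<exists>S g. S \<subseteq> {..<n} \<and> card S = N \<and>
    polyfun S (2 * c * (card (UNIV :: 'a set) - 1)) g \<and> (\<forall>x\<in>supported_on S. poly_eval f x = g x)"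
proof -
  define q1 where "q1 = card (UNIV :: 'a set) - 1"
  \<comment> \<open>The even part of the exponent is absorbed by
    \<open>(N\<^sup>2) ^ c \<le> n ^ c\<close>; the extra 1 leaves a factor \<open>N\<close> against
    \<open>n\<close>, which makes the bound strict.\<close>
  define r where "r = 2 * c + 1"
  define T where "T = {m \<in> Poly_Mapping.keys f. r \<le> card (Poly_Mapping.keys m)}"
  have finT: "finite T" by (simp add: T_def)
  have "\<exists>S\<subseteq>{..<n}. card S = N \<and>
      card {t\<in>T. Poly_Mapping.keys t \<subseteq> S} * card {..<n} ^ r \<le> card T * N ^ r"
    using f N finT by (intro exists_subset_containing_few) (auto simp: T_def poly_in_vars_def)
  then obtain S where S: "S \<subseteq> {..<n}" "card S = N"
      "card {t\<in>T. Poly_Mapping.keys t \<subseteq> S} * n ^ r \<le> card T * N ^ r"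
    by auto
  note S(3)
  also have "card T * N ^ r \<le> n ^ c * N ^ r"
    using f(2) card_mono[of "Poly_Mapping.keys f" T]
    by (intro mult_le_mono1) (auto simp: T_def num_monomials_def)
  also have "N ^ r = (N\<^sup>2) ^ c * N"
    by (simp add: r_def power_mult)
  also have "n ^ c * ((N\<^sup>2) ^ c * N) \<le> n ^ c * (n ^ c * N)"
    using N by (intro mult_le_mono2 mult_le_mono1 power_mono) auto
  also have "\<dots> < n ^ c * (n ^ c * n)"
    using N by simp
  also have "\<dots> = 1 * n ^ r"
    by (simp add: r_def mult_2 power_add)
  finally have "card {t\<in>T. Poly_Mapping.keys t \<subseteq> S} < 1"
    by (simp only: mult_less_cancel2)
  then have "{t\<in>T. Poly_Mapping.keys t \<subseteq> S} = {}"
    using finT by simp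
  then have few: "card (Poly_Mapping.keys m) \<le> 2 * c"
    if "m \<in> Poly_Mapping.keys f" "Poly_Mapping.keys m \<subseteq> S" for m
    using that by (fastforce simp: T_def r_def)
  define M where "M = {m \<in> Poly_Mapping.keys f. Poly_Mapping.keys m \<subseteq> S}"
  define g where "g x = (\<Sum>m\<in>M. Poly_Mapping.lookup f m *
     (\<Prod>i\<in>Poly_Mapping.keys m. x i ^ Poly_Mapping.lookup m i))" for x
  have "polyfun S (2 * c * q1) g"
    unfolding g_def
  proof (rule polyfun_sum)
    fix m assume m: "m \<in> M"
    have "polyfun S (0 + (\<Sum>i\<in>Poly_Mapping.keys m. q1)) (\<lambda>x. Poly_Mapping.lookup f m *
       (\<Prod>i\<in>Poly_Mapping.keys m. x i ^ Poly_Mapping.lookup m i))"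
      using m unfolding q1_def
      by (intro polyfun_mult polyfun_const polyfun_prod polyfun_coord_power) (auto simp: M_def)
    then show "polyfun S (2 * c * q1) (\<lambda>x. Poly_Mapping.lookup f m *
       (\<Prod>i\<in>Poly_Mapping.keys m. x i ^ Poly_Mapping.lookup m i))"
      by (rule polyfun_mono) (use few m in \<open>auto simp: M_def\<close>)
  qed
  moreover have "poly_eval f x = g x" if "x \<in> supported_on S" for x
    unfolding poly_eval_def g_def
  proof (rule sum.mono_neutral_right)
    show "\<forall>m\<in>Poly_Mapping.keys f - M. Poly_Mapping.lookup f m *
      (\<Prod>i\<in>Poly_Mapping.keys m. x i ^ Poly_Mapping.lookup m i) = 0"
    proof
      fix m assume "m \<in> Poly_Mapping.keys f - M"
      then obtain i where i: "i \<in> Poly_Mapping.keys m" "i \<notin> S" by (auto simp: M_def)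
      \<comment> \<open>Membership in the keys makes the exponent positive, which excludes
        \<open>0 ^ 0 = 1\<close>.\<close>
      then have "x i ^ Poly_Mapping.lookup m i = 0"
        using that by (simp add: supported_on_def in_keys_iff)
      then have "(\<Prod>i\<in>Poly_Mapping.keys m. x i ^ Poly_Mapping.lookup m i) = 0"
        using i by (intro prod_zero) auto
      then show "Poly_Mapping.lookup f m *
        (\<Prod>i\<in>Poly_Mapping.keys m. x i ^ Poly_Mapping.lookup m i) = 0" by simp
    qed
  qed (auto simp: M_def)
  ultimately show ?thesis
    using S by (auto simp: q1_def)
qed

text \<open>The span of the constructed basis stays inside F^S, where \<open>poly_eval f\<close>
  agrees with a function of degree at most \<open>d\<close>. The affine subspace obtained passes
  through the origin.\<close>

lemma sparse_constant_on_affine_subspace: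
  fixes f :: "'a::{field,finite} mpoly"
  assumes f: "poly_in_vars n f" "num_monomials f \<le> n ^ c"
    and N: "1 \<le> N" "N\<^sup>2 \<le> n" "N < n"
    and d: "d = 2 * c * (card (UNIV :: 'a set) - 1)" "d \<ge> 1" "d * (d + 2) * k ^ d < N"
  shows "\<exists>A. affine_subspace n k A \<and> poly_eval f constant_on A"
proof -
  obtain S g where S: "S \<subseteq> {..<n}" "card S = N" and g: "polyfun S d g"
    and fg: "\<And>x. x \<in> supported_on S \<Longrightarrow> poly_eval f x = g x"
    using sparse_restriction_polyfun[OF f N] d(1) by blast
  have finS: "finite S" using S finite_subset by blast
  have less: "d * (d + 2) * k ^ d < card S" using d(3) S(2) by simp
  obtain B where B: "card B = k" "coord.independent B" "B \<subseteq> supported_on S"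
      "\<And>v. v \<in> coord.span B \<Longrightarrow> g v = g 0"
    using polyfun_const_basis[OF g d(2) finS less] by blast
  have span: "coord.span B \<subseteq> supported_on S"
    using B subspace_supported_on by (intro coord.span_minimal) auto
  have "supported_on S \<subseteq> coord_space n"
    using S(1) by (fastforce simp: supported_on_def coord_space_def)
  then have "affine_subspace n k (coord.span B)"
    unfolding affine_subspace_def using span B
    by (intro exI[of _ 0] exI[of _ "coord.span B"])
       (auto simp: coord_space_def coord.dim_eq_card_independent)
  moreover have "poly_eval f constant_on coord.span B"
    unfolding constant_on_def using span fg B(4) by (metis subsetD)
  ultimately show ?thesis by blast
qed

section \<open>Growth of the dimension as a function of the number of variables\<close>

lemma affine_subspace_singleton: "affine_subspace n 0 {0}"
  unfolding affine_subspace_def using coord.dim_eq_card[of "{}" "{0}"]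
  by (intro exI[of _ 0] exI[of _ "{0}"]) (auto simp: coord_space_def coord.dependent_def)

text \<open>Rounding down loses less than 1, hence at most half of the value once the value is at
  least 2.\<close>

lemma bigomega_nat_floor_powr:
  fixes e a :: real
  assumes "e > 0" "a > 0"
  shows "(\<lambda>n. real (nat \<lfloor>e * real n powr a\<rfloor>)) \<in> \<Omega>(\<lambda>n. real n powr a)"
proof (rule landau_omega.bigI)
  show "e / 2 > 0" using assms by simp
  have "eventually (\<lambda>n. real n powr a \<ge> 2 / e) at_top"
    using assms by real_asymp
  then show "eventually (\<lambda>n. e / 2 * norm (real n powr a) \<le> norm (real (nat \<lfloor>e * real n powr a\<rfloor>))) at_top"
  proof eventually_elim
    case (elim n)
    then have "e * real n powr a \<ge> 2"
      using assms by (simp add: field_simps)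
    then show ?case by (simp add: field_simps) linarith
  qed
qed

theorem theorem3:
  fixes q c :: nat
  assumes "card (UNIV :: 'a::{field,finite} set) = q" and "c \<ge> 1"
  shows "\<exists>d :: nat \<Rightarrow> nat.
           (\<lambda>n. real (d n)) \<in> \<Omega>(\<lambda>n. real n powr (1 / (4 * (real q - 1) * real c))) \<and>
           (\<forall>n. \<forall>f :: 'a mpoly. poly_in_vars n f \<and> num_monomials f \<le> n ^ c \<longrightarrow>
              (\<exists>A. affine_subspace n (d n) A \<and> poly_eval f constant_on A))"
proof -
  have q: "q \<ge> 2" using card_field_ge_2[where ?'a = 'a] assms by simp
  define D where "D = 2 * c * (q - 1)"
  have D: "D \<ge> 1" using q assms by (simp add: D_def)
  \<comment> \<open>The exponent combines a square root, from passing to about \<open>sqrt n\<close>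
    variables, with a \<open>D\<close>-th root, from the condition on \<open>k ^ D\<close>.\<close>
  define a where "a = 1 / (2 * real D)"
  have a: "a = 1 / (4 * (real q - 1) * real c)"
    using q by (simp add: a_def D_def of_nat_diff)
  \<comment> \<open>Chosen so that \<open>4 * D * (D + 2) * d n ^ D \<le> sqrt n\<close>; the factor
    4 leaves room for rounding \<open>sqrt n\<close> down to \<open>N\<close>.\<close>
  define e where "e = (1 / (4 * real D * (real D + 2))) powr (1 / real D)"
  define d where "d n = nat \<lfloor>e * real n powr a\<rfloor>" for n
  have "e > 0" "a > 0" using D by (auto simp: e_def a_def)
  then have "(\<lambda>n. real (d n)) \<in> \<Omega>(\<lambda>n. real n powr a)"
    unfolding d_def by (rule bigomega_nat_floor_powr)
  moreover have "\<exists>A. affine_subspace n (d n) A \<and> poly_eval f constant_on A"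
    if f: "poly_in_vars n f" "num_monomials f \<le> n ^ c" for n and f :: "'a mpoly"
  proof (cases "d n = 0")
    \<comment> \<open>For small \<open>n\<close>, including \<open>n = 0\<close>, a single point
      suffices.\<close>
    case True
    then show ?thesis
      using affine_subspace_singleton[of n] by (auto simp: constant_on_def)
  next
    case False
    define s where "s = sqrt (real n)"
    have "n \<noteq> 0"
      using False by (intro notI) (simp add: d_def)
    then have n: "n > 0" by simp
    have "real (d n) \<le> e * real n powr a"
      using False by (simp add: d_def)
    then have "real (d n) ^ D \<le> (e * real n powr a) ^ D"
      by (intro power_mono) auto
    also have "\<dots> = e ^ D * (real n powr a) ^ D"
      by (rule power_mult_distrib)
    also have "e ^ D = 1 / (4 * real D * (real D + 2))"
      using D by (simp add: e_def powr_powr flip: powr_realpow')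
    also have "(real n powr a) ^ D = s"
      using D n by (simp add: a_def s_def powr_powr powr_half_sqrt flip: powr_realpow')
    finally have "real (d n) ^ D \<le> s / (4 * real D * (real D + 2))" by simp
    moreover have "4 * real D * (real D + 2) > 0" using D by simp
    ultimately have "real (d n) ^ D * (4 * real D * (real D + 2)) \<le> s"
      by (simp only: pos_le_divide_eq)
    then have bound: "4 * real (D * (D + 2) * d n ^ D) \<le> s"
      by (simp add: algebra_simps)
    define N where "N = nat \<lfloor>s\<rfloor>"
    \<comment> \<open>A positive dimension already forces \<open>sqrt n \<ge> 4\<close>, which is
      what makes \<open>N\<close> large enough for the strict inequalities below.\<close>
    have "D * (D + 2) * d n ^ D \<ge> 1"
      using D False by simp
    then have s4: "s \<ge> 4"
      using bound by linarith
    have N: "real N \<le> s" "s < real N + 1"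
      using s4 unfolding N_def by linarith+
    then have "D * (D + 2) * d n ^ D < N"
      using bound s4 by linarith
    moreover have "real (N\<^sup>2) \<le> s\<^sup>2"
      using N s4 by (simp add: power_mono)
    then have N2: "N\<^sup>2 \<le> n"
      by (simp add: s_def)
    have N_ge: "N \<ge> 2" using N s4 by linarith
    then have "2 * N \<le> N\<^sup>2"
      by (simp add: power2_eq_square)
    then have "N < n"
      using N2 N_ge by linarith
    ultimately show ?thesis
      using N2 N_ge D assms(1) by (intro sparse_constant_on_affine_subspace[OF f, of N D]) (auto simp: D_def)
  qed
  ultimately show ?thesis
    unfolding a by blast
qed

end
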